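(* Let $M^2$ be a complete Alexandrov surface with non-negative curvature and let $\Omega_0\subset M^2$ be a compact convex domain. Suppose that $\hat\sigma:[-\varepsilon,L_0+\varepsilon]\to M^2$ is a length-minimizing geodesic of unit speed with $\hat\sigma([-\varepsilon,L_0+\varepsilon])\subset\partial\Omega_0$, let $f(x)=d(x,\partial\Omega_0)$, and for $q\in\partial\Omega_0$ let $\varphi_q:[0,\delta]\to M^2$ be the gradient semi-flow pointing inside $\Omega_0$, with $$\frac{d^+\varphi_q}{dt}=\left.\frac{\nabla f}{|\nabla f|^2}\right|_{\varphi_q(t)},\qquad \varphi_q(0)=q\in\partial\Omega_0.$$ Suppose that $\sigma_t:[0,L_0]\to M^2$ is given by $\sigma_t(s)=\varphi_{\hat\sigma(s)}(t)$. Then $$\frac{d^2[L(\sigma_t)]}{dt^2}(0)\le0,$$ where $L(\sigma_t)$ denotes the length of $\sigma_t$.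
   Context: A complete Alexandrov surface $M^2$ of non-negative curvature is a two-dimensional complete metric space $(M^2,d)$ in which any two points are joined by a curve of length equal to their distance (a length-minimizing geodesic), and such that for every length-minimizing geodesic $\sigma:[0,\ell]\to M^2$ of unit speed and every $p\notin\sigma([0,\ell])$ the function $t\mapsto\frac12[d(p,\sigma(t))]^2-\frac{t^2}{2}$ is concave. A subset $\Omega$ is convex if any two of its points $p,q$ are joined by a length-minimizing geodesic $\sigma:[0,\ell]\to M^2$ with $\sigma((0,\ell))\subset\Omega$. The function $f(x)=d(x,\partial\Omega_0)$ is concave on $\Omega_0$, and $\nabla f$ denotes its gradient in the sense of Alexandrov geometry (Petrunin's gradient for semi-concave functions); $\frac{d^+}{dt}$ denotes the right derivative, and the derivatives of $t\mapsto L(\sigma_t)$ at $t=0$ are taken from the right, as the flow is defined for $t\ge0$.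
   Formalization: The second derivative of L(σ_t) at 0 need not exist, so the bound is for the upper right second derivative, which equals the iterated right derivative whenever that exists; finiteness of the length and existence of the first right derivative at 0 are also proved. *)

theory Defs
  imports "HOL-Analysis.Analysis"
begin

section \<open>Curves in metric spaces\<close>

definition curve_length :: "(real \<Rightarrow> 'a::metric_space) \<Rightarrow> real \<Rightarrow> real \<Rightarrow> ereal" where
  "curve_length \<gamma> a b =
     (SUP (n, u) \<in> {(n::nat, u::nat \<Rightarrow> real). u 0 = a \<and> u n = b \<and> (\<forall>i<n. u i \<le> u (Suc i))}.
        ereal (\<Sum>i<n. dist (\<gamma> (u i)) (\<gamma> (u (Suc i)))))"

text \<open>Length-minimizing geodesics, parametrized by arc length.\<close>

definition min_geodesic :: "(real \<Rightarrow> 'a::metric_space) \<Rightarrow> real \<Rightarrow> real \<Rightarrow> bool" where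
  "min_geodesic \<gamma> a b \<longleftrightarrow>
     a \<le> b \<and> (\<forall>s\<in>{a..b}. \<forall>t\<in>{a..b}. dist (\<gamma> s) (\<gamma> t) = \<bar>s - t\<bar>)"

definition geodesically_convex :: "'a::metric_space set \<Rightarrow> bool" where
  "geodesically_convex \<Omega> \<longleftrightarrow>
     (\<forall>p\<in>\<Omega>. \<forall>q\<in>\<Omega>. \<exists>\<gamma> l. min_geodesic \<gamma> 0 l \<and> \<gamma> 0 = p \<and> \<gamma> l = q \<and> \<gamma> ` {0<..<l} \<subseteq> \<Omega>)"

definition geodesically_concave_on :: "'a::metric_space set \<Rightarrow> ('a \<Rightarrow> real) \<Rightarrow> bool" where
  "geodesically_concave_on \<Omega> f \<longleftrightarrow>
     (\<forall>\<gamma> l. min_geodesic \<gamma> 0 l \<and> \<gamma> ` {0..l} \<subseteq> \<Omega> \<longrightarrow> concave_on {0..l} (\<lambda>t. f (\<gamma> t)))"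


section \<open>Alexandrov surfaces of non-negative curvature\<close>

text \<open>Boundedness is required of the covering sets because \<^const>\<open>diameter\<close> is unspecified on
  unbounded sets. If there is no admissible countable cover, the infimum is \<open>\<infinity>\<close>.\<close>

definition hausdorff_premeasure :: "real \<Rightarrow> real \<Rightarrow> 'a::metric_space set \<Rightarrow> ennreal" where
  "hausdorff_premeasure s \<delta> S =
     (INF U \<in> {U :: nat \<Rightarrow> 'a set. S \<subseteq> (\<Union>i. U i) \<and> (\<forall>i. bounded (U i) \<and> diameter (U i) \<le> \<delta>)}.
        (\<Sum>i. ennreal (diameter (U i) powr s)))"

definition hausdorff_measure :: "real \<Rightarrow> 'a::metric_space set \<Rightarrow> ennreal" where
  "hausdorff_measure s S = (SUP \<delta> \<in> {0<..}. hausdorff_premeasure s \<delta> S)"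

text \<open>Only exponents \<open>s > 0\<close> are used, since \<open>0 powr 0 = 0\<close>; this does not change the infimum.\<close>

definition hausdorff_dim :: "'a::metric_space set \<Rightarrow> ereal" where
  "hausdorff_dim S = (INF s \<in> {s::real. 0 < s \<and> hausdorff_measure s S = 0}. ereal s)"

text \<open>The whole type is the space; completeness is supplied by the class.\<close>

definition nonneg_curved_alexandrov_surface :: "'a::complete_space itself \<Rightarrow> bool" where
  "nonneg_curved_alexandrov_surface _ \<longleftrightarrow>
     hausdorff_dim (UNIV :: 'a set) = 2 \<and>
     (\<forall>x y::'a. \<exists>\<gamma>. min_geodesic \<gamma> 0 (dist x y) \<and> \<gamma> 0 = x \<and> \<gamma> (dist x y) = y) \<and>
     (\<forall>(\<gamma> :: real \<Rightarrow> 'a) l p. min_geodesic \<gamma> 0 l \<and> p \<notin> \<gamma> ` {0..l} \<longrightarrow>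
        concave_on {0..l} (\<lambda>t. (dist p (\<gamma> t))\<^sup>2 / 2 - t\<^sup>2 / 2))"


section \<open>Tangent cones and gradients\<close>

text \<open>The tangent cone of \<open>\<Omega>\<close> at \<open>p\<close> is the metric completion of the space of germs of
  minimizing geodesics of constant speed \<open>r \<ge> 0\<close> that start at \<open>p\<close> and stay in \<open>\<Omega>\<close>, with the
  (pseudo)distance \<open>lim d(c(t), c'(t)) / t\<close> as \<open>t\<close> tends to \<open>0\<close> from the right. A vector of the
  cone is represented by a Cauchy sequence of germs, so that distinct sequences may stand for the
  same vector. The vertex of the cone is the constant germ.\<close>

definition geodesic_germ :: "'a::metric_space set \<Rightarrow> 'a \<Rightarrow> (real \<Rightarrow> 'a) \<Rightarrow> bool" where
  "geodesic_germ \<Omega> p c \<longleftrightarrow> c 0 = p \<and>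
     (\<exists>r\<ge>0. \<exists>T>0. c ` {0..T} \<subseteq> \<Omega> \<and>
        (\<forall>s\<in>{0..T}. \<forall>t\<in>{0..T}. dist (c s) (c t) = r * \<bar>s - t\<bar>))"

definition germ_dist :: "(real \<Rightarrow> 'a::metric_space) \<Rightarrow> (real \<Rightarrow> 'a) \<Rightarrow> real" where
  "germ_dist c c' = Lim (at_right 0) (\<lambda>t. dist (c t) (c' t) / t)"

definition germ_norm :: "(real \<Rightarrow> 'a::metric_space) \<Rightarrow> real" where
  "germ_norm c = germ_dist c (\<lambda>_. c 0)"

text \<open>By the law of cosines in the cone this is \<open>|c| |c'| cos \<alpha>\<close>, where \<open>\<alpha>\<close> is the angle
  between \<open>c\<close> and \<open>c'\<close>.\<close>

definition germ_inner :: "(real \<Rightarrow> 'a::metric_space) \<Rightarrow> (real \<Rightarrow> 'a) \<Rightarrow> real" where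
  "germ_inner c c' = ((germ_norm c)\<^sup>2 + (germ_norm c')\<^sup>2 - (germ_dist c c')\<^sup>2) / 2"

definition tangent_vector :: "'a::metric_space set \<Rightarrow> 'a \<Rightarrow> (nat \<Rightarrow> real \<Rightarrow> 'a) \<Rightarrow> bool" where
  "tangent_vector \<Omega> p V \<longleftrightarrow>
     (\<forall>n. geodesic_germ \<Omega> p (V n)) \<and>
     (\<forall>e>0. \<exists>N. \<forall>m\<ge>N. \<forall>n\<ge>N. germ_dist (V m) (V n) < e)"

definition tangent_norm :: "(nat \<Rightarrow> real \<Rightarrow> 'a::metric_space) \<Rightarrow> real" where
  "tangent_norm V = lim (\<lambda>n. germ_norm (V n))"

definition tangent_inner ::
  "(nat \<Rightarrow> real \<Rightarrow> 'a::metric_space) \<Rightarrow> (nat \<Rightarrow> real \<Rightarrow> 'a) \<Rightarrow> real" where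
  "tangent_inner V W = lim (\<lambda>n. germ_inner (V n) (W n))"

definition tangent_scale ::
  "real \<Rightarrow> (nat \<Rightarrow> real \<Rightarrow> 'a::metric_space) \<Rightarrow> (nat \<Rightarrow> real \<Rightarrow> 'a)" where
  "tangent_scale r V = (\<lambda>n t. V n (r * t))"

text \<open>The differential of \<open>f\<close>: the right derivative along germs, extended continuously to the
  completion.\<close>

definition differential :: "('a::metric_space \<Rightarrow> real) \<Rightarrow> (nat \<Rightarrow> real \<Rightarrow> 'a) \<Rightarrow> real" where
  "differential f V = lim (\<lambda>n. Lim (at_right 0) (\<lambda>t. (f (V n t) - f (V n 0)) / t))"

text \<open>\<open>G\<close> is the gradient at \<open>p\<close> of \<open>f\<close> as a function on \<open>\<Omega>\<close>. At interior points of \<open>\<Omega>\<close> the set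
  \<open>\<Omega>\<close> plays no role; at its boundary points only directions into \<open>\<Omega>\<close> are admitted.\<close>

definition is_gradient ::
  "'a::metric_space set \<Rightarrow> ('a \<Rightarrow> real) \<Rightarrow> 'a \<Rightarrow> (nat \<Rightarrow> real \<Rightarrow> 'a) \<Rightarrow> bool" where
  "is_gradient \<Omega> f p G \<longleftrightarrow>
     tangent_vector \<Omega> p G \<and>
     (\<forall>W. tangent_vector \<Omega> p W \<longrightarrow> differential f W \<le> tangent_inner G W) \<and>
     differential f G = tangent_inner G G"

text \<open>The right derivative of the curve \<open>\<alpha>\<close> at \<open>t\<close> is the tangent vector \<open>V\<close>: the germs \<open>V n\<close>
  approximate \<open>\<alpha>\<close> to first order with an error that vanishes as \<open>n\<close> grows.\<close>

definition has_right_tangent ::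
  "(real \<Rightarrow> 'a::metric_space) \<Rightarrow> real \<Rightarrow> (nat \<Rightarrow> real \<Rightarrow> 'a) \<Rightarrow> bool" where
  "has_right_tangent \<alpha> t V \<longleftrightarrow>
     (\<lambda>n. Limsup (at_right 0) (\<lambda>h. ereal (dist (\<alpha> (t + h)) (V n h) / h))) \<longlonglongrightarrow> 0"

text \<open>An integral curve on \<open>[0,\<delta>]\<close>, staying in \<open>\<Omega>\<close>, of \<open>\<nabla>f / |\<nabla>f|\<^sup>2\<close>.\<close>

definition normalized_gradient_curve ::
  "'a::metric_space set \<Rightarrow> ('a \<Rightarrow> real) \<Rightarrow> real \<Rightarrow> (real \<Rightarrow> 'a) \<Rightarrow> bool" where
  "normalized_gradient_curve \<Omega> f \<delta> \<alpha> \<longleftrightarrow>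
     continuous_on {0..\<delta>} \<alpha> \<and> \<alpha> ` {0..\<delta>} \<subseteq> \<Omega> \<and>
     (\<forall>t\<in>{0..<\<delta>}. \<exists>G. is_gradient \<Omega> f (\<alpha> t) G \<and> 0 < tangent_norm G \<and>
        has_right_tangent \<alpha> t (tangent_scale (1 / (tangent_norm G)\<^sup>2) G))"


section \<open>Right derivatives of the length\<close>

text \<open>The length of equidistant curves need not be twice differentiable, not even from the right:
  for the metric \<open>dt\<^sup>2 + h(t)\<^sup>2 ds\<^sup>2\<close> with \<open>h\<close> concave, \<open>h = 1\<close> for \<open>t \<le> 0\<close>, the length is a
  multiple of \<open>h\<close>, and \<open>h'(t) / t\<close> may oscillate or tend to \<open>-\<infinity>\<close> as \<open>t\<close> decreases to \<open>0\<close>. The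
  second derivative is therefore taken in the upper sense, which agrees with the ordinary iterated
  right derivative whenever the latter exists.\<close>

definition upper_right_deriv :: "(real \<Rightarrow> real) \<Rightarrow> real \<Rightarrow> ereal" where
  "upper_right_deriv g t = Limsup (at_right t) (\<lambda>u. ereal ((g u - g t) / (u - t)))"

definition upper_right_deriv2 :: "(real \<Rightarrow> real) \<Rightarrow> real \<Rightarrow> ereal" where
  "upper_right_deriv2 g t =
     Limsup (at_right t)
       (\<lambda>u. (upper_right_deriv g u - upper_right_deriv g t) / ereal (u - t))"

lemma upper_right_deriv_eq:
  assumes "(g has_real_derivative D) (at_right t)"
  shows "upper_right_deriv g t = ereal D"
  using assms unfolding upper_right_deriv_def has_field_derivative_iff
  by (intro lim_imp_Limsup) auto

lemma upper_right_deriv2_eq: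
  assumes "(g has_real_derivative g' t) (at_right t)"
    and "\<forall>\<^sub>F u in at_right t. (g has_real_derivative g' u) (at_right u)"
    and "(g' has_real_derivative D) (at_right t)"
  shows "upper_right_deriv2 g t = ereal D"
proof -
  have "\<forall>\<^sub>F u in at_right t.
      (upper_right_deriv g u - upper_right_deriv g t) / ereal (u - t)
        = ereal ((g' u - g' t) / (u - t))"
    using assms(2) eventually_at_right_less[of t]
    by eventually_elim (simp add: upper_right_deriv_eq upper_right_deriv_eq[OF assms(1)])
  then have "upper_right_deriv2 g t = upper_right_deriv g' t"
    unfolding upper_right_deriv2_def upper_right_deriv_def[of g'] by (rule Limsup_eq)
  then show ?thesis
    using upper_right_deriv_eq[OF assms(3)] by simp
qed

end

theory Submission
  imports Defs
begin

text \<open>The length \<open>L(\<sigma>\<^sub>t)\<close> is nonincreasing in \<open>t\<close>, and its right derivative at \<open>0\<close> exists and is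
  \<open>0\<close>. Together these give the claim: the upper right derivative is nonpositive at every \<open>u > 0\<close>
  and zero at \<open>0\<close>, so its difference quotients there are nonpositive.

  Both facts come from one first variation estimate (\<open>first_variation\<close>). Let \<open>\<alpha>\<close> be an integral
  curve of \<open>\<nabla>f / |\<nabla>f|\<^sup>2\<close> and \<open>w\<close> a minimizing geodesic of unit speed in \<open>\<Omega>\<^sub>0\<close> from \<open>\<alpha> t\<close> to a
  point \<open>w l\<close> with \<open>f (w l) \<ge> f (\<alpha> t)\<close>. Concavity gives \<open>df(w) \<ge> 0\<close>, the gradient satisfies
  \<open>\<langle>\<nabla>f, w\<rangle> \<ge> df(w)\<close>, and non-negative curvature, in the form of hinge comparison
  (\<open>hinge_comparison\<close>), yields \<open>d(\<alpha>(t + h), w l) \<le> l + o(h)\<close>.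

  Monotonicity. The normalization of the field makes \<open>f\<close> grow at unit rate along the flow, so at
  each time all points of \<open>\<sigma>\<^sub>t\<close> lie on the level \<open>t\<close> of \<open>f\<close>. The midpoint of a geodesic between
  two of them lies on that level or higher, by concavity. Applying the estimate from both ends
  towards the midpoint shows that the distance between two flow lines has nonpositive upper right
  derivative, hence is nonincreasing (\<open>normalized_gradient_curves_contract\<close>). The sums over
  partitions that define \<open>L(\<sigma>\<^sub>t)\<close> are then nonincreasing too, and so is their supremum. In
  particular \<open>L(\<sigma>\<^sub>t) \<le> L(\<sigma>\<^sub>0) = L\<^sub>0\<close> is finite.

  Derivative at \<open>0\<close>. This is where the extension of the geodesic beyond \<open>[0, L\<^sub>0]\<close> enters. As \<open>f\<close>
  vanishes along it, the estimate applies to the pieces from \<open>\<sigma>(0)\<close> back to \<open>\<sigma>(-\<epsilon>)\<close> and from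
  \<open>\<sigma>(L\<^sub>0)\<close> on to \<open>\<sigma>(L\<^sub>0 + \<epsilon>)\<close>, and the triangle inequality gives
  \<open>L\<^sub>0 + 2\<epsilon> \<le> (\<epsilon> + o(t)) + d(\<sigma>\<^sub>t(0), \<sigma>\<^sub>t(L\<^sub>0)) + (\<epsilon> + o(t))\<close>. Hence
  \<open>L\<^sub>0 - o(t) \<le> d(\<sigma>\<^sub>t(0), \<sigma>\<^sub>t(L\<^sub>0)) \<le> L(\<sigma>\<^sub>t) \<le> L\<^sub>0\<close>.\<close>

section \<open>One-sided limits and Dini derivatives\<close>

text \<open>Both the angle between two geodesics and the directional derivatives of a concave function are
limits of monotone quotients. Besides the existence of the limit, it matters that the limit bounds
the quotient at every scale: this is what turns infinitesimal data into inequalities between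
distances.\<close>

lemma mono_bdd_below_limit_at_right_0:
  fixes k :: "real \<Rightarrow> real"
  assumes "0 < T"
    and mono: "\<And>s t. 0 < s \<Longrightarrow> s \<le> t \<Longrightarrow> t \<le> T \<Longrightarrow> k s \<le> k t"
    and bdd: "\<And>t. 0 < t \<Longrightarrow> t \<le> T \<Longrightarrow> B \<le> k t"
  obtains I where "(k \<longlongrightarrow> I) (at_right 0)" "\<And>t. 0 < t \<Longrightarrow> t \<le> T \<Longrightarrow> I \<le> k t"
proof -
  define I where "I = Inf (k ` {0<..T})"
  have bb: "bdd_below (k ` {0<..T})"
    using bdd by (auto intro!: bdd_belowI[of _ B])
  have le: "I \<le> k t" if "0 < t" "t \<le> T" for t
    unfolding I_def by (rule cInf_lower) (use that bb in auto)
  have "(k \<longlongrightarrow> I) (at_right 0)"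
  proof (rule order_tendstoI)
    fix a assume "a < I"
    then show "\<forall>\<^sub>F x in at_right 0. a < k x"
      using le \<open>0 < T\<close> unfolding eventually_at_right_field
      by (meson less_le_trans less_imp_le)
  next
    fix a assume "I < a"
    then obtain x where x: "0 < x" "x \<le> T" "k x < a"
      unfolding I_def using cInf_less_iff[OF _ bb] \<open>0 < T\<close> by auto
    then show "\<forall>\<^sub>F y in at_right 0. k y < a"
      using mono[of _ x] unfolding eventually_at_right_field
      by (meson le_less_trans less_imp_le)
  qed
  then show thesis using le that by blast
qed

lemma concave_on_slope_from_0:
  assumes "concave_on {0..T} F" "0 < s" "s \<le> t" "t \<le> (T::real)"
  shows "(F t - F 0) / t \<le> (F s - F 0) / s"
proof -
  have "F ((1 - s/t) *\<^sub>R 0 + (s/t) *\<^sub>R t) \<ge> (1 - s/t) * F 0 + (s/t) * F t"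
    by (rule concave_onD[OF assms(1)]) (use assms in auto)
  then have "s * (F t - F 0) \<le> t * (F s - F 0)"
    using assms by (simp add: field_simps)
  then show ?thesis using assms by (simp add: field_simps)
qed

lemma concave_on_slope_limit:
  fixes F :: "real \<Rightarrow> real"
  assumes "concave_on {0..T} F" "0 < T"
    and "\<And>t. 0 < t \<Longrightarrow> t \<le> T \<Longrightarrow> (F t - F 0) / t \<le> B"
  obtains I where "((\<lambda>t. (F t - F 0) / t) \<longlongrightarrow> I) (at_right 0)" "(F T - F 0) / T \<le> I"
proof -
  obtain I where I: "((\<lambda>t. - ((F t - F 0) / t)) \<longlongrightarrow> I) (at_right 0)"
    "\<And>t. 0 < t \<Longrightarrow> t \<le> T \<Longrightarrow> I \<le> - ((F t - F 0) / t)"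
  proof (rule mono_bdd_below_limit_at_right_0[of T "\<lambda>t. - ((F t - F 0) / t)" "-B"])
    show "- ((F s - F 0) / s) \<le> - ((F t - F 0) / t)" if "0 < s" "s \<le> t" "t \<le> T" for s t
      using concave_on_slope_from_0[OF assms(1) that] by simp
    show "- B \<le> - ((F t - F 0) / t)" if "0 < t" "t \<le> T" for t
      using assms(3)[OF that] by simp
  qed (use assms(2) in auto)
  show thesis
    using that[of "-I"] tendsto_minus[OF I(1)] I(2)[of T] assms(2) by simp
qed

text \<open>At the last point of \<^term>\<open>{a..b}\<close> where \<open>g\<close> lies on or below the line of slope \<open>e\<close> through
\<open>(a, g a)\<close>, the Dini bound would produce later such points, unless that point is \<open>b\<close>.\<close>

lemma Dini_nonpos_imp_le:
  fixes g :: "real \<Rightarrow> real"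
  assumes "a \<le> b" and cont: "continuous_on {a..b} g"
    and Dini: "\<And>t e. a \<le> t \<Longrightarrow> t < b \<Longrightarrow> 0 < e \<Longrightarrow> \<forall>\<^sub>F h in at_right 0. g (t + h) \<le> g t + e * h"
  shows "g b \<le> g a"
proof (rule field_le_epsilon)
  fix e' :: real assume "0 < e'"
  define e where "e = e' / (b - a + 1)"
  have e: "0 < e" "e * (b - a) \<le> e'"
    using \<open>0 < e'\<close> \<open>a \<le> b\<close> unfolding e_def by (auto simp: field_simps)
  define Z where "Z = {x\<in>{a..b}. g x \<le> g a + e * (x - a)}"
  have "compact ({a..b} \<inter> {x\<in>{a..b}. g x \<le> g a + e * (x - a)})"
    by (intro compact_Int_closed compact_Icc continuous_on_closed_Collect_le closed_atLeastAtMost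
        cont continuous_intros)
  moreover have "{a..b} \<inter> {x\<in>{a..b}. g x \<le> g a + e * (x - a)} = Z"
    unfolding Z_def by auto
  ultimately have "compact Z" by simp
  moreover have "a \<in> Z" using \<open>a \<le> b\<close> by (simp add: Z_def)
  ultimately obtain s where s: "s \<in> Z" and s_max: "\<And>x. x \<in> Z \<Longrightarrow> x \<le> s"
    using compact_attains_sup[of Z] by blast
  have "s = b"
  proof (rule ccontr)
    assume "s \<noteq> b"
    then have "a \<le> s" "s < b" using s by (auto simp: Z_def)
    then obtain d where d: "0 < d" "\<And>h. 0 < h \<Longrightarrow> h < d \<Longrightarrow> g (s + h) \<le> g s + e * h"
      using Dini[of s e] e(1) by (auto simp: eventually_at_right_field)
    define h where "h = min d (b - s) / 2"
    have h: "0 < h" "h < d" "s + h \<le> b"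
      using d(1) \<open>s < b\<close> by (auto simp: h_def min_def field_simps)
    have "g (s + h) \<le> g a + e * (s + h - a)"
      using d(2)[OF h(1,2)] s by (simp add: Z_def algebra_simps)
    then have "s + h \<in> Z" using h \<open>a \<le> s\<close> by (simp add: Z_def)
    then show False using s_max h(1) by fastforce
  qed
  then show "g b \<le> g a + e'"
    using s e(2) by (simp add: Z_def)
qed

text \<open>The first variation of a distance says nothing once the distance vanishes, and gradient curves may
meet. Truncating \<open>g\<close> from below at a level \<open>m > 0\<close> removes the zeros of \<open>g\<close>; then \<open>m\<close> tends to
\<open>0\<close>.\<close>

lemma continuous_Dini_nonpos_where_pos_imp_le:
  fixes g :: "real \<Rightarrow> real"
  assumes "a \<le> b" and cont: "continuous_on {a..b} g" and "0 \<le> g a"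
    and Dini: "\<And>t e. a \<le> t \<Longrightarrow> t < b \<Longrightarrow> 0 < g t \<Longrightarrow> 0 < e \<Longrightarrow> \<forall>\<^sub>F h in at_right 0. g (t + h) \<le> g t + e * h"
  shows "g b \<le> g a"
proof -
  have *: "max (g b) m \<le> max (g a) m" if "0 < m" for m
  proof (rule Dini_nonpos_imp_le[where g = "\<lambda>t. max (g t) m"])
    show "a \<le> b" by fact
    show "continuous_on {a..b} (\<lambda>t. max (g t) m)"
      by (intro continuous_intros cont)
    fix t e :: real assume t: "a \<le> t" "t < b" and e: "0 < e"
    show "\<forall>\<^sub>F h in at_right 0. max (g (t + h)) m \<le> max (g t) m + e * h"
    proof (cases "g t < m")
      case True
      have "continuous_on {t..b} g"
        using cont by (rule continuous_on_subset) (use t in auto)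
      then have "(g \<longlongrightarrow> g t) (at_right t)"
        using t(2) by (rule continuous_on_Icc_at_rightD)
      then have "\<forall>\<^sub>F x in at_right t. g x < m"
        using True by (rule order_tendstoD)
      then have "\<forall>\<^sub>F h in at_right 0. g (t + h) < m"
        by (simp add: eventually_at_right_to_0[of _ t] add.commute)
      then show ?thesis
        using eventually_at_right_less[of "0::real"] 
        by eventually_elim (use e True in \<open>auto simp: max_def\<close>)
    next
      case False
      then have "\<forall>\<^sub>F h in at_right 0. g (t + h) \<le> g t + e * h"
        using Dini t e that by simp
      then show ?thesis
        using eventually_at_right_less[of "0::real"] 
      proof eventually_elim
        case (elim h)
        then have "0 \<le> e * h" using e by simp
        then show ?case using elim(1) False by auto
      qed
    qed
  qed
  show ?thesis
  proof (cases "g a = 0")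
    case True
    have "g b \<le> 0 + m" if "0 < m" for m
      using *[OF that] True that by simp
    then have "g b \<le> 0" by (rule field_le_epsilon)
    then show ?thesis using True by simp
  next
    case False
    then show ?thesis using *[of "g a"] \<open>0 \<le> g a\<close> by simp
  qed
qed

section \<open>Hinge comparison\<close>

text \<open>Speed \<open>0\<close> is included, as in the definition of germs: the constant germ is the vertex of the
tangent cone.\<close>

definition constant_speed :: "(real \<Rightarrow> 'a::metric_space) \<Rightarrow> real \<Rightarrow> real \<Rightarrow> bool" where
  "constant_speed c r T \<longleftrightarrow>
     0 \<le> r \<and> 0 < T \<and> (\<forall>s\<in>{0..T}. \<forall>t\<in>{0..T}. dist (c s) (c t) = r * \<bar>s - t\<bar>)"

lemma geodesic_germ_iff:
  "geodesic_germ \<Omega> p c \<longleftrightarrow> c 0 = p \<and> (\<exists>r T. constant_speed c r T \<and> c ` {0..T} \<subseteq> \<Omega>)"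
  unfolding geodesic_germ_def constant_speed_def by blast

lemma min_geodesic_imp_constant_speed:
  "min_geodesic c 0 T \<Longrightarrow> 0 < T \<Longrightarrow> constant_speed c 1 T"
  unfolding constant_speed_def min_geodesic_def by simp

lemma constant_speed_reparam:
  assumes "constant_speed c r T" "0 < r"
  shows "min_geodesic (\<lambda>s. c (s / r)) 0 (r * T)"
  unfolding min_geodesic_def
proof (intro conjI ballI)
  show "0 \<le> r * T" using assms by (auto simp: constant_speed_def)
  fix s t assume st: "s \<in> {0..r * T}" "t \<in> {0..r * T}"
  then have "s / r \<in> {0..T}" "t / r \<in> {0..T}"
    using assms(2) by (auto simp: field_simps)
  then have "dist (c (s / r)) (c (t / r)) = r * \<bar>s / r - t / r\<bar>"
    using assms by (auto simp: constant_speed_def)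
  also have "\<dots> = \<bar>s - t\<bar>"
    using assms(2) by (simp add: abs_mult_pos' right_diff_distrib)
  finally show "dist (c (s / r)) (c (t / r)) = \<bar>s - t\<bar>" .
qed

lemma dist_constant_speed_from_start:
  "constant_speed c r T \<Longrightarrow> 0 \<le> t \<Longrightarrow> t \<le> T \<Longrightarrow> dist (c 0) (c t) = r * t"
  unfolding constant_speed_def by auto

text \<open>The curvature condition speaks of points off the geodesic only. For a point on the geodesic the
function is affine, so the restriction can be dropped; below, the comparison is applied to arbitrary
pairs of geodesics from a point, which may overlap.\<close>

lemma dist_sq_concave_min_geodesic:
  fixes \<gamma> :: "real \<Rightarrow> 'a::complete_space"
  assumes "nonneg_curved_alexandrov_surface TYPE('a)" "min_geodesic \<gamma> 0 l"
  shows "concave_on {0..l} (\<lambda>t. (dist p (\<gamma> t))\<^sup>2 / 2 - t\<^sup>2 / 2)"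
proof (cases "p \<in> \<gamma> ` {0..l}")
  case False
  then show ?thesis
    using assms unfolding nonneg_curved_alexandrov_surface_def by blast
next
  case True
  then obtain a where a: "a \<in> {0..l}" "p = \<gamma> a" by blast
  have eq: "(dist p (\<gamma> t))\<^sup>2 / 2 - t\<^sup>2 / 2 = a\<^sup>2 / 2 - a * t" if "t \<in> {0..l}" for t
    using a that assms(2) by (simp add: min_geodesic_def power2_eq_square field_simps)
  show ?thesis
    unfolding concave_on_iff
  proof (intro conjI ballI allI impI)
    fix x y u v :: real
    assume xy: "x \<in> {0..l}" "y \<in> {0..l}" and uv: "0 \<le> u" "0 \<le> v" "u + v = 1"
    then have "u *\<^sub>R x + v *\<^sub>R y \<in> {0..l}" by (intro convexD) auto
    moreover have "u * (a\<^sup>2 / 2 - a * x) + v * (a\<^sup>2 / 2 - a * y) = (u + v) * (a\<^sup>2 / 2) - a * (u * x + v * y)"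
      by (simp add: algebra_simps)
    ultimately show "u * ((dist p (\<gamma> x))\<^sup>2 / 2 - x\<^sup>2 / 2) + v * ((dist p (\<gamma> y))\<^sup>2 / 2 - y\<^sup>2 / 2)
        \<le> (dist p (\<gamma> (u *\<^sub>R x + v *\<^sub>R y)))\<^sup>2 / 2 - (u *\<^sub>R x + v *\<^sub>R y)\<^sup>2 / 2"
      using xy uv(3) by (simp only: eq) simp
  qed simp
qed

lemma dist_sq_slope_antimono:
  fixes c :: "real \<Rightarrow> 'a::complete_space"
  assumes surf: "nonneg_curved_alexandrov_surface TYPE('a)" and c: "constant_speed c r T"
    and st: "0 < s" "s \<le> t" "t \<le> T"
  shows "((dist p (c t))\<^sup>2 - (r * t)\<^sup>2 - (dist p (c 0))\<^sup>2) / t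
       \<le> ((dist p (c s))\<^sup>2 - (r * s)\<^sup>2 - (dist p (c 0))\<^sup>2) / s"
proof (cases "r = 0")
  case True
  then have "c t = c 0" "c s = c 0"
    using dist_constant_speed_from_start[OF c, of t] dist_constant_speed_from_start[OF c, of s] st
    by auto
  then show ?thesis using True by simp
next
  case False
  then have r: "0 < r" using c by (simp add: constant_speed_def)
  define h where "h u = (dist p (c (u / r)))\<^sup>2 / 2 - u\<^sup>2 / 2" for u
  have "concave_on {0..r * T} h"
    unfolding h_def by (rule dist_sq_concave_min_geodesic[OF surf constant_speed_reparam[OF c r]])
  then have "(h (r * t) - h 0) / (r * t) \<le> (h (r * s) - h 0) / (r * s)"
    by (rule concave_on_slope_from_0) (use st r in auto)
  then have "2 * r * ((h (r * t) - h 0) / (r * t)) \<le> 2 * r * ((h (r * s) - h 0) / (r * s))"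
    using r by (intro mult_left_mono) auto
  moreover have "2 * r * ((h (r * u) - h 0) / (r * u)) = ((dist p (c u))\<^sup>2 - (r * u)\<^sup>2 - (dist p (c 0))\<^sup>2) / u"
    if "0 < u" for u
    using that r unfolding h_def by (simp add: field_simps)
  ultimately show ?thesis using st by simp
qed

text \<open>Let \<open>k s t\<close> be \<open>r r'\<close> times the cosine of the comparison angle of the hinge with sides
\<open>c|[0,s]\<close> and \<open>c'|[0,t]\<close>. Concavity of the squared distance makes \<open>k\<close> nondecreasing in each
variable. Hence the limit \<open>I\<close> of \<open>k t t\<close> at \<open>0\<close> exists, which is the existence of the distance
of germs, and \<open>k s t\<close> is at least \<open>I\<close> for all \<open>s\<close> and \<open>t\<close>, which is the comparison of the hinge
with the Euclidean hinge of the same angle. The law of cosines expresses \<open>I\<close> by the distance of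
the germs.\<close>

lemma hinge_comparison:
  fixes c c' :: "real \<Rightarrow> 'a::complete_space"
  assumes surf: "nonneg_curved_alexandrov_surface TYPE('a)"
    and c: "constant_speed c r T" and c': "constant_speed c' r' T'" and start: "c 0 = c' 0"
  shows "((\<lambda>t. dist (c t) (c' t) / t) \<longlongrightarrow> germ_dist c c') (at_right 0)"
    and "0 \<le> s \<Longrightarrow> s \<le> T \<Longrightarrow> 0 \<le> t \<Longrightarrow> t \<le> T' \<Longrightarrow>
      (dist (c s) (c' t))\<^sup>2 \<le> (r * s)\<^sup>2 + (r' * t)\<^sup>2 - 2 * s * t * ((r\<^sup>2 + r'\<^sup>2 - (germ_dist c c')\<^sup>2) / 2)"
proof -
  define k where "k s t = ((r * s)\<^sup>2 + (r' * t)\<^sup>2 - (dist (c s) (c' t))\<^sup>2) / (2 * s * t)" for s t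
  have mono1: "k s u \<le> k t u" if "0 < s" "s \<le> t" "t \<le> T" "0 < u" "u \<le> T'" for s t u
  proof -
    have "((dist (c' u) (c t))\<^sup>2 - (r * t)\<^sup>2 - (dist (c' u) (c 0))\<^sup>2) / t / (2 * u)
       \<le> ((dist (c' u) (c s))\<^sup>2 - (r * s)\<^sup>2 - (dist (c' u) (c 0))\<^sup>2) / s / (2 * u)"
      by (rule divide_right_mono[OF dist_sq_slope_antimono[OF surf c]]) (use that in auto)
    moreover have "dist (c' u) (c 0) = r' * u"
      using dist_constant_speed_from_start[OF c', of u] that start by (simp add: dist_commute)
    ultimately show ?thesis
      using that by (simp add: k_def dist_commute field_simps)
  qed
  have mono2: "k u s \<le> k u t" if "0 < s" "s \<le> t" "t \<le> T'" "0 < u" "u \<le> T" for s t u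
  proof -
    have "((dist (c u) (c' t))\<^sup>2 - (r' * t)\<^sup>2 - (dist (c u) (c' 0))\<^sup>2) / t / (2 * u)
       \<le> ((dist (c u) (c' s))\<^sup>2 - (r' * s)\<^sup>2 - (dist (c u) (c' 0))\<^sup>2) / s / (2 * u)"
      by (rule divide_right_mono[OF dist_sq_slope_antimono[OF surf c']]) (use that in auto)
    moreover have "dist (c u) (c' 0) = r * u"
      using dist_constant_speed_from_start[OF c, of u] that start by (simp add: dist_commute)
    ultimately show ?thesis
      using that by (simp add: k_def dist_commute field_simps)
  qed
  define m where "m = min T T'"
  have m: "0 < m" "m \<le> T" "m \<le> T'"
    using c c' by (auto simp: m_def constant_speed_def)
  have kk: "(dist (c t) (c' t) / t)\<^sup>2 = r\<^sup>2 + r'\<^sup>2 - 2 * k t t" if "0 < t" for t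
    using that by (simp add: k_def field_simps power2_eq_square)
  have lower: "- (r * r') \<le> k t t" if t: "0 < t" "t \<le> m" for t
  proof -
    have "dist (c t) (c' t) \<le> dist (c 0) (c t) + dist (c' 0) (c' t)"
      using start dist_triangle[of "c t" "c' t" "c 0"] by (simp add: dist_commute)
    also have "\<dots> = (r + r') * t"
      using dist_constant_speed_from_start[OF c, of t] dist_constant_speed_from_start[OF c', of t] t m
      by (simp add: algebra_simps)
    finally have "(dist (c t) (c' t) / t)\<^sup>2 \<le> (r + r')\<^sup>2"
      using t by (intro power_mono) (auto simp: field_simps)
    then show ?thesis using kk[OF t(1)] by (simp add: power2_sum)
  qed
  obtain I where I: "((\<lambda>t. k t t) \<longlongrightarrow> I) (at_right 0)" "\<And>t. 0 < t \<Longrightarrow> t \<le> m \<Longrightarrow> I \<le> k t t"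
  proof (rule mono_bdd_below_limit_at_right_0[of m "\<lambda>t. k t t" "- (r * r')"])
    fix s t assume "0 < s" "s \<le> t" "t \<le> m"
    then show "k s s \<le> k t t"
      using mono1[of s t s] mono2[of s t t] m by linarith
  qed (use m lower in auto)
  have "((\<lambda>t. sqrt (r\<^sup>2 + r'\<^sup>2 - 2 * k t t)) \<longlongrightarrow> sqrt (r\<^sup>2 + r'\<^sup>2 - 2 * I)) (at_right 0)"
    by (intro tendsto_intros I)
  moreover have "\<forall>\<^sub>F t in at_right 0. sqrt (r\<^sup>2 + r'\<^sup>2 - 2 * k t t) = dist (c t) (c' t) / t"
    using eventually_at_right_less[of "0::real"]
    by eventually_elim (simp add: kk[symmetric])
  ultimately have lim: "((\<lambda>t. dist (c t) (c' t) / t) \<longlongrightarrow> sqrt (r\<^sup>2 + r'\<^sup>2 - 2 * I)) (at_right 0)"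
    by (rule Lim_transform_eventually)
  then have gd: "germ_dist c c' = sqrt (r\<^sup>2 + r'\<^sup>2 - 2 * I)"
    unfolding germ_dist_def by (intro tendsto_Lim) auto
  show "((\<lambda>t. dist (c t) (c' t) / t) \<longlongrightarrow> germ_dist c c') (at_right 0)"
    using lim gd by simp
  have "((\<lambda>t. (dist (c t) (c' t) / t)\<^sup>2) \<longlongrightarrow> (sqrt (r\<^sup>2 + r'\<^sup>2 - 2 * I))\<^sup>2) (at_right 0)"
    by (intro tendsto_intros lim)
  moreover have "((\<lambda>t. (dist (c t) (c' t) / t)\<^sup>2) \<longlongrightarrow> r\<^sup>2 + r'\<^sup>2 - 2 * I) (at_right 0)"
  proof (rule Lim_transform_eventually)
    show "((\<lambda>t. r\<^sup>2 + r'\<^sup>2 - 2 * k t t) \<longlongrightarrow> r\<^sup>2 + r'\<^sup>2 - 2 * I) (at_right 0)"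
      by (intro tendsto_intros I)
    show "\<forall>\<^sub>F t in at_right 0. r\<^sup>2 + r'\<^sup>2 - 2 * k t t = (dist (c t) (c' t) / t)\<^sup>2"
      using eventually_at_right_less[of "0::real"]
      by eventually_elim (simp add: kk)
  qed
  ultimately have "(germ_dist c c')\<^sup>2 = r\<^sup>2 + r'\<^sup>2 - 2 * I"
    unfolding gd by (rule tendsto_unique[rotated]) simp
  then have Ieq: "(r\<^sup>2 + r'\<^sup>2 - (germ_dist c c')\<^sup>2) / 2 = I" by simp
  assume st: "0 \<le> s" "s \<le> T" "0 \<le> t" "t \<le> T'"
  show "(dist (c s) (c' t))\<^sup>2 \<le> (r * s)\<^sup>2 + (r' * t)\<^sup>2 - 2 * s * t * ((r\<^sup>2 + r'\<^sup>2 - (germ_dist c c')\<^sup>2) / 2)"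
  proof (cases "s = 0 \<or> t = 0")
    case True
    then show ?thesis
      using dist_constant_speed_from_start[OF c, of s] dist_constant_speed_from_start[OF c', of t] st start
      by (auto simp: dist_commute)
  next
    case False
    define u where "u = min s t"
    have u: "0 < u" "u \<le> m" "u \<le> s" "u \<le> t" using False st by (auto simp: u_def m_def)
    have "I \<le> k u u" using I(2) u by simp
    also have "\<dots> \<le> k s u" using mono1[of u s u] u st by simp
    also have "\<dots> \<le> k s t" using mono2[of u t s] u st by simp
    finally have "2 * s * t * I \<le> (r * s)\<^sup>2 + (r' * t)\<^sup>2 - (dist (c s) (c' t))\<^sup>2"
      using u unfolding k_def by (simp add: field_simps)
    then show ?thesis unfolding Ieq by simp
  qed
qed

section \<open>Tangent cones\<close>

lemma geodesic_germE:
  assumes "geodesic_germ \<Omega> p c"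
  obtains r T where "c 0 = p" "constant_speed c r T" "c ` {0..T} \<subseteq> \<Omega>"
  using assms unfolding geodesic_germ_iff by blast

lemma germ_dist_tendsto:
  fixes c c' :: "real \<Rightarrow> 'a::complete_space"
  assumes "nonneg_curved_alexandrov_surface TYPE('a)" "geodesic_germ \<Omega> p c" "geodesic_germ \<Omega> p c'"
  shows "((\<lambda>t. dist (c t) (c' t) / t) \<longlongrightarrow> germ_dist c c') (at_right 0)"
  using assms(2,3) by (elim geodesic_germE) (rule hinge_comparison(1)[OF assms(1)], auto)

lemma germ_dist_commute: "germ_dist c c' = germ_dist c' c"
  unfolding germ_dist_def by (simp add: dist_commute)

lemma germ_dist_self [simp]: "germ_dist c c = 0"
  unfolding germ_dist_def by (simp add: tendsto_Lim)

lemma germ_dist_triangle: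
  fixes c c' c'' :: "real \<Rightarrow> 'a::complete_space"
  assumes "nonneg_curved_alexandrov_surface TYPE('a)"
    "geodesic_germ \<Omega> p c" "geodesic_germ \<Omega> p c'" "geodesic_germ \<Omega> p c''"
  shows "germ_dist c c'' \<le> germ_dist c c' + germ_dist c' c''"
proof (rule tendsto_le)
  show "((\<lambda>t. dist (c t) (c' t) / t + dist (c' t) (c'' t) / t)
      \<longlongrightarrow> germ_dist c c' + germ_dist c' c'') (at_right 0)"
    by (intro tendsto_add germ_dist_tendsto[OF assms(1,2,3)] germ_dist_tendsto[OF assms(1,3,4)])
  show "((\<lambda>t. dist (c t) (c'' t) / t) \<longlongrightarrow> germ_dist c c'') (at_right 0)"
    by (rule germ_dist_tendsto[OF assms(1,2,4)])
  show "\<forall>\<^sub>F t in at_right 0. dist (c t) (c'' t) / t \<le> dist (c t) (c' t) / t + dist (c' t) (c'' t) / t"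
    using eventually_at_right_less[of "0::real"]
    by eventually_elim (simp add: dist_triangle divide_right_mono flip: add_divide_distrib)
qed simp

lemma germ_norm_eq_speed:
  assumes "constant_speed c r T"
  shows "germ_norm c = r"
proof -
  have "\<forall>\<^sub>F t in at_right 0. r = dist (c t) (c 0) / t"
    unfolding eventually_at_right_field
    using assms dist_constant_speed_from_start[OF assms]
    by (intro exI[of _ T]) (auto simp: constant_speed_def dist_commute)
  then have "((\<lambda>t. dist (c t) (c 0) / t) \<longlongrightarrow> r) (at_right 0)"
    by (rule Lim_transform_eventually[OF tendsto_const])
  then show ?thesis
    unfolding germ_norm_def germ_dist_def by (intro tendsto_Lim) auto
qed

lemma geodesic_germ_const:
  assumes "geodesic_germ \<Omega> p c"
  shows "geodesic_germ \<Omega> p (\<lambda>_. p)"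
proof -
  have "p \<in> \<Omega>" using assms by (auto elim!: geodesic_germE simp: constant_speed_def)
  moreover have "constant_speed (\<lambda>_. p) 0 1" by (simp add: constant_speed_def)
  ultimately show ?thesis
    unfolding geodesic_germ_iff by (metis image_subsetI)
qed

lemma hinge_comparison_germ_inner:
  fixes c c' :: "real \<Rightarrow> 'a::complete_space"
  assumes "nonneg_curved_alexandrov_surface TYPE('a)"
    "constant_speed c r T" "constant_speed c' r' T'" "c 0 = c' 0" "s \<in> {0..T}" "t \<in> {0..T'}"
  shows "(dist (c s) (c' t))\<^sup>2 \<le> (r * s)\<^sup>2 + (r' * t)\<^sup>2 - 2 * s * t * germ_inner c c'"
  using hinge_comparison(2)[OF assms(1-4)] assms(5,6)
  unfolding germ_inner_def germ_norm_eq_speed[OF assms(2)] germ_norm_eq_speed[OF assms(3)] by simp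

lemma tangent_vector_germ: "tangent_vector \<Omega> p V \<Longrightarrow> geodesic_germ \<Omega> p (V n)"
  unfolding tangent_vector_def by blast

lemma tangent_vector_const: "geodesic_germ \<Omega> p w \<Longrightarrow> tangent_vector \<Omega> p (\<lambda>_. w)"
  unfolding tangent_vector_def by simp

text \<open>Tangent vectors are Cauchy sequences of germs, so every functional on germs that is \<open>1\<close>-Lipschitz
for their distance converges along them. This applies to the norm, to the distance from a fixed
germ and to directional derivatives.\<close>

lemma convergent_along_tangent_vector:
  fixes F :: "(real \<Rightarrow> 'a::metric_space) \<Rightarrow> real"
  assumes V: "tangent_vector \<Omega> p V"
    and F: "\<And>c c'. geodesic_germ \<Omega> p c \<Longrightarrow> geodesic_germ \<Omega> p c' \<Longrightarrow> F c - F c' \<le> germ_dist c c'"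
  shows "convergent (\<lambda>n. F (V n))"
proof (rule Cauchy_convergent, rule CauchyI)
  fix e :: real assume "0 < e"
  then obtain N where N: "\<And>m n. N \<le> m \<Longrightarrow> N \<le> n \<Longrightarrow> germ_dist (V m) (V n) < e"
    using V unfolding tangent_vector_def by metis
  have "norm (F (V m) - F (V n)) < e" if "N \<le> m" "N \<le> n" for m n
    using F[of "V m" "V n"] F[of "V n" "V m"] N[OF that] tangent_vector_germ[OF V]
    by (simp add: germ_dist_commute[of "V n"] abs_less_iff)
  then show "\<exists>M. \<forall>m\<ge>M. \<forall>n\<ge>M. norm (F (V m) - F (V n)) < e" by blast
qed

lemma germ_norm_tendsto:
  fixes V :: "nat \<Rightarrow> real \<Rightarrow> 'a::complete_space"
  assumes surf: "nonneg_curved_alexandrov_surface TYPE('a)" and V: "tangent_vector \<Omega> p V"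
  shows "(\<lambda>n. germ_norm (V n)) \<longlonglongrightarrow> tangent_norm V"
proof -
  have "convergent (\<lambda>n. germ_norm (V n))"
  proof (rule convergent_along_tangent_vector[OF V])
    fix c c' :: "real \<Rightarrow> 'a"
    assume c: "geodesic_germ \<Omega> p c" "geodesic_germ \<Omega> p c'"
    then have "c 0 = p" "c' 0 = p" by (auto elim: geodesic_germE)
    then show "germ_norm c - germ_norm c' \<le> germ_dist c c'"
      using germ_dist_triangle[OF surf c geodesic_germ_const[OF c(1)]] by (simp add: germ_norm_def)
  qed
  then show ?thesis unfolding tangent_norm_def by (simp add: convergent_LIMSEQ_iff)
qed

lemma germ_inner_tendsto:
  fixes V :: "nat \<Rightarrow> real \<Rightarrow> 'a::complete_space"
  assumes surf: "nonneg_curved_alexandrov_surface TYPE('a)" and V: "tangent_vector \<Omega> p V"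
    and w: "geodesic_germ \<Omega> p w"
  shows "(\<lambda>n. germ_inner (V n) w) \<longlonglongrightarrow> tangent_inner V (\<lambda>_. w)"
proof -
  have "convergent (\<lambda>n. germ_dist (V n) w)"
  proof (rule convergent_along_tangent_vector[OF V])
    fix c c' :: "real \<Rightarrow> 'a"
    assume "geodesic_germ \<Omega> p c" "geodesic_germ \<Omega> p c'"
    then show "germ_dist c w - germ_dist c' w \<le> germ_dist c c'"
      using germ_dist_triangle[OF surf _ _ w] by fastforce
  qed
  then obtain D where "(\<lambda>n. germ_dist (V n) w) \<longlonglongrightarrow> D" by (auto simp: convergent_def)
  then have "(\<lambda>n. germ_inner (V n) w) \<longlonglongrightarrow> ((tangent_norm V)\<^sup>2 + (germ_norm w)\<^sup>2 - D\<^sup>2) / 2"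
    unfolding germ_inner_def by (intro tendsto_intros germ_norm_tendsto[OF surf V]) auto
  then show ?thesis unfolding tangent_inner_def by (metis limI)
qed

lemma tangent_inner_self:
  fixes V :: "nat \<Rightarrow> real \<Rightarrow> 'a::complete_space"
  assumes "nonneg_curved_alexandrov_surface TYPE('a)" "tangent_vector \<Omega> p V"
  shows "tangent_inner V V = (tangent_norm V)\<^sup>2"
  unfolding tangent_inner_def germ_inner_def germ_dist_self
  by (rule limI) (use germ_norm_tendsto[OF assms] in \<open>auto intro!: tendsto_eq_intros\<close>)

section \<open>Differentials of concave Lipschitz functions\<close>

definition germ_deriv :: "('a::metric_space \<Rightarrow> real) \<Rightarrow> (real \<Rightarrow> 'a) \<Rightarrow> real" where
  "germ_deriv f c = Lim (at_right 0) (\<lambda>t. (f (c t) - f (c 0)) / t)"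

lemma concave_on_constant_speed:
  assumes "geodesically_concave_on \<Omega> f" "constant_speed c r T" "c ` {0..T} \<subseteq> \<Omega>"
  shows "concave_on {0..T} (\<lambda>t. f (c t))"
proof (cases "r = 0")
  case True
  have const: "f (c t) = f (c 0)" if "t \<in> {0..T}" for t
    using dist_constant_speed_from_start[OF assms(2), of t] that True by simp
  show ?thesis
    unfolding concave_on_iff
  proof (intro conjI ballI allI impI)
    fix x y u v :: real
    assume *: "x \<in> {0..T}" "y \<in> {0..T}" "0 \<le> u" "0 \<le> v" "u + v = 1"
    then have "u *\<^sub>R x + v *\<^sub>R y \<in> {0..T}" by (intro convexD) auto
    then have "f (c (u *\<^sub>R x + v *\<^sub>R y)) = f (c 0)" by (rule const)
    also have "\<dots> = u * f (c 0) + v * f (c 0)"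
      using *(5) by (simp flip: distrib_right)
    finally have "f (c (u *\<^sub>R x + v *\<^sub>R y)) = u * f (c 0) + v * f (c 0)" .
    then show "u * f (c x) + v * f (c y) \<le> f (c (u *\<^sub>R x + v *\<^sub>R y))"
      using const[OF *(1)] const[OF *(2)] by simp
  qed simp
next
  case False
  then have r: "0 < r" using assms(2) by (simp add: constant_speed_def)
  have "(\<lambda>s. c (s / r)) ` {0..r * T} \<subseteq> \<Omega>"
    using assms(3) r by (auto simp: field_simps image_subset_iff)
  then have "concave_on {0..r * T} (\<lambda>s. f (c (s / r)))"
    using assms(1) constant_speed_reparam[OF assms(2) r] unfolding geodesically_concave_on_def by blast
  then have conc: "u * f (c (x / r)) + v * f (c (y / r)) \<le> f (c ((u * x + v * y) / r))"
    if "x \<in> {0..r * T}" "y \<in> {0..r * T}" "0 \<le> u" "0 \<le> v" "u + v = 1" for u v x y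
    using that unfolding concave_on_iff real_scaleR_def by blast
  have "u * f (c x) + v * f (c y) \<le> f (c (u * x + v * y))"
    if "x \<in> {0..T}" "y \<in> {0..T}" "0 \<le> u" "0 \<le> v" "u + v = 1" for u v x y
  proof -
    have "(u * (r * x) + v * (r * y)) / r = u * x + v * y"
      using r by (simp add: field_simps)
    then show ?thesis
      using conc[of "r * x" "r * y" u v] that r by simp
  qed
  then show ?thesis unfolding concave_on_iff by simp
qed

text \<open>Here \<open>f\<close> stands for the distance from the boundary. Its concavity and its Lipschitz constant \<open>1\<close>
carry all estimates on gradient curves: the one bounds directional derivatives from below by slopes
of chords, the other makes them continuous on the tangent cone.\<close>

locale concave_function_on_convex_set =
  fixes \<Omega> :: "'a::complete_space set" and f :: "'a \<Rightarrow> real"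
  assumes surface: "nonneg_curved_alexandrov_surface TYPE('a)"
    and concave: "geodesically_concave_on \<Omega> f"
    and lipschitz: "\<And>x y. \<bar>f x - f y\<bar> \<le> dist x y"
    and convex: "geodesically_convex \<Omega>"
begin

text \<open>The second part is the supporting-line inequality: the directional derivative at the start of a
geodesic is at least the slope of the chord. It makes the derivative towards a point of the same
or a higher level nonnegative.\<close>

lemma slope_tendsto_germ_deriv:
  assumes "constant_speed c r T" "c ` {0..T} \<subseteq> \<Omega>"
  shows "((\<lambda>t. (f (c t) - f (c 0)) / t) \<longlongrightarrow> germ_deriv f c) (at_right 0)"
    and "(f (c T) - f (c 0)) / T \<le> germ_deriv f c"
proof -
  have T: "0 < T" using assms(1) by (simp add: constant_speed_def)
  have "(f (c t) - f (c 0)) / t \<le> r" if "0 < t" "t \<le> T" for t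
    using lipschitz[of "c t" "c 0"] dist_constant_speed_from_start[OF assms(1), of t] that
    by (simp add: field_simps dist_commute)
  then obtain I where "((\<lambda>t. (f (c t) - f (c 0)) / t) \<longlongrightarrow> I) (at_right 0)"
    "(f (c T) - f (c 0)) / T \<le> I"
    by (rule concave_on_slope_limit[OF concave_on_constant_speed[OF concave assms] T])
  moreover from this have "germ_deriv f c = I"
    unfolding germ_deriv_def by (intro tendsto_Lim) auto
  ultimately show "((\<lambda>t. (f (c t) - f (c 0)) / t) \<longlongrightarrow> germ_deriv f c) (at_right 0)"
    and "(f (c T) - f (c 0)) / T \<le> germ_deriv f c" by auto
qed

lemma geodesic_germ_slope_tendsto:
  "geodesic_germ \<Omega> p c \<Longrightarrow> ((\<lambda>t. (f (c t) - f (c 0)) / t) \<longlongrightarrow> germ_deriv f c) (at_right 0)"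
  by (elim geodesic_germE) (rule slope_tendsto_germ_deriv)

text \<open>Germs at the same point start at the same value of \<open>f\<close>, so the difference of the two slopes at
\<open>t\<close> involves only \<open>f (c t) - f (c' t)\<close>.\<close>

lemma germ_deriv_diff_le:
  assumes "geodesic_germ \<Omega> p c" "geodesic_germ \<Omega> p c'"
  shows "germ_deriv f c - germ_deriv f c' \<le> germ_dist c c'"
proof (rule tendsto_le)
  show "((\<lambda>t. dist (c t) (c' t) / t) \<longlongrightarrow> germ_dist c c') (at_right 0)"
    by (rule germ_dist_tendsto[OF surface assms])
  show "((\<lambda>t. (f (c t) - f (c 0)) / t - (f (c' t) - f (c' 0)) / t)
      \<longlongrightarrow> germ_deriv f c - germ_deriv f c') (at_right 0)"
    by (intro tendsto_diff geodesic_germ_slope_tendsto[OF assms(1)] geodesic_germ_slope_tendsto[OF assms(2)])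
  have "c 0 = c' 0" using assms by (auto elim!: geodesic_germE)
  show "\<forall>\<^sub>F t in at_right 0. (f (c t) - f (c 0)) / t - (f (c' t) - f (c' 0)) / t \<le> dist (c t) (c' t) / t"
    using eventually_at_right_less[of "0::real"]
  proof eventually_elim
    case (elim t)
    then show ?case
      using lipschitz[of "c t" "c' t"] \<open>c 0 = c' 0\<close>
      by (simp add: divide_right_mono flip: diff_divide_distrib)
  qed
qed simp

lemma germ_deriv_tendsto_differential:
  assumes "tangent_vector \<Omega> p V"
  shows "(\<lambda>n. germ_deriv f (V n)) \<longlonglongrightarrow> differential f V"
proof -
  have "convergent (\<lambda>n. germ_deriv f (V n))"
    by (rule convergent_along_tangent_vector[OF assms germ_deriv_diff_le])
  then show ?thesis
    unfolding differential_def germ_deriv_def by (simp add: convergent_LIMSEQ_iff)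
qed

lemma differential_const: "differential f (\<lambda>_. w) = germ_deriv f w"
  unfolding differential_def germ_deriv_def by simp

end

section \<open>Gradient curves\<close>

text \<open>The right tangent is used in this form: up to an error of slope \<open>e\<close>, the curve may be replaced by
one of the geodesics that represent its tangent vector.\<close>

lemma has_right_tangent_approx:
  assumes "has_right_tangent \<alpha> t (tangent_scale r V)" "0 < e"
  shows "\<forall>\<^sub>F n in sequentially. \<forall>\<^sub>F h in at_right 0. dist (\<alpha> (t + h)) (V n (r * h)) \<le> e * h"
proof -
  have "\<forall>\<^sub>F n in sequentially. Limsup (at_right 0) (\<lambda>h. ereal (dist (\<alpha> (t + h)) (V n (r * h)) / h)) < ereal e"
    using assms unfolding has_right_tangent_def tangent_scale_def
    by (intro order_tendstoD(2)) (auto simp: zero_ereal_def)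
  then show ?thesis
  proof eventually_elim
    case (elim n)
    show ?case
      using Limsup_lessD[OF elim] eventually_at_right_less[of "0::real"]
      by eventually_elim (simp add: field_simps)
  qed
qed

context concave_function_on_convex_set
begin

text \<open>The gradient curve does not move away, to first order, from a point \<open>w l\<close> at the same or a higher
level. The derivative of \<open>f\<close> in the direction of \<open>w\<close> is nonnegative by concavity, and the gradient
\<open>G\<close> dominates it: \<open>\<langle>G, w\<rangle> \<ge> df(w) \<ge> 0\<close>. So the angle between the curve and \<open>w\<close> is at most a
right angle, and hinge comparison gives \<open>d(\<alpha>(t + h), w l) \<le> l + o(h)\<close>.\<close>

lemma first_variation:
  assumes G: "is_gradient \<Omega> f (\<alpha> t) G" and pos: "0 < tangent_norm G"
    and tangent: "has_right_tangent \<alpha> t (tangent_scale (1 / (tangent_norm G)\<^sup>2) G)"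
    and w: "min_geodesic w 0 l" "0 < l" "w ` {0..l} \<subseteq> \<Omega>" "w 0 = \<alpha> t"
    and le: "f (\<alpha> t) \<le> f (w l)" and e: "0 < e"
  shows "\<forall>\<^sub>F h in at_right 0. dist (\<alpha> (t + h)) (w l) \<le> l + e * h"
proof -
  define k where "k = 1 / (tangent_norm G)\<^sup>2"
  have k: "0 < k" using pos by (simp add: k_def)
  have V: "tangent_vector \<Omega> (\<alpha> t) G" using G by (simp add: is_gradient_def)
  have cw: "constant_speed w 1 l" using w by (simp add: min_geodesic_imp_constant_speed)
  have germ: "geodesic_germ \<Omega> (\<alpha> t) w"
    using cw w unfolding geodesic_germ_iff by blast
  have "0 \<le> germ_deriv f w"
    using slope_tendsto_germ_deriv(2)[OF cw w(3)] le w(2,4)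
    by (smt (verit) divide_nonneg_pos)
  also have "\<dots> \<le> tangent_inner G (\<lambda>_. w)"
    using G tangent_vector_const[OF germ] unfolding is_gradient_def differential_const[symmetric] by blast
  finally have nonneg: "0 \<le> tangent_inner G (\<lambda>_. w)" .
  have "- (e / (4 * k)) < tangent_inner G (\<lambda>_. w)"
    using nonneg e k by (smt (verit) divide_pos_pos)
  then have "\<forall>\<^sub>F n in sequentially. - (e / (4 * k)) < germ_inner (G n) w"
    by (rule order_tendstoD(1)[OF germ_inner_tendsto[OF surface V germ]])
  moreover have "\<forall>\<^sub>F n in sequentially. \<forall>\<^sub>F h in at_right 0. dist (\<alpha> (t + h)) (G n (k * h)) \<le> e / 2 * h"
    by (rule has_right_tangent_approx) (use tangent e in \<open>auto simp: k_def\<close>)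
  ultimately have "\<forall>\<^sub>F n in sequentially. - (e / (4 * k)) < germ_inner (G n) w \<and>
      (\<forall>\<^sub>F h in at_right 0. dist (\<alpha> (t + h)) (G n (k * h)) \<le> e / 2 * h)"
    by (rule eventually_conj)
  then obtain n where n: "- (e / (4 * k)) < germ_inner (G n) w"
    "\<forall>\<^sub>F h in at_right 0. dist (\<alpha> (t + h)) (G n (k * h)) \<le> e / 2 * h"
    by (auto simp: eventually_sequentially)
  obtain r T where rT: "G n 0 = \<alpha> t" "constant_speed (G n) r T"
    using tangent_vector_germ[OF V, of n] by (auto elim: geodesic_germE)
  have T: "0 < T" using rT by (simp add: constant_speed_def)
  have "((\<lambda>h. (r * k)\<^sup>2 * h / (2 * l)) \<longlongrightarrow> (r * k)\<^sup>2 * 0 / (2 * l)) (at_right 0)"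
    by (intro tendsto_intros) (use w in auto)
  then have small: "\<forall>\<^sub>F h in at_right 0. (r * k)\<^sup>2 * h / (2 * l) < e / 4"
    by (rule order_tendstoD) (use e in auto)
  have "\<forall>\<^sub>F h in at_right 0. h < T / k"
    using T k by (intro order_tendstoD(2)[OF tendsto_ident_at]) auto
  then show ?thesis
    using n(2) small eventually_at_right_less[of "0::real"]
  proof eventually_elim
    case (elim h)
    let ?d = "dist (G n (k * h)) (w l)"
    \<comment> \<open>Hinge with sides \<open>G n\<close> up to time \<open>k * h\<close> and \<open>w\<close> up to time \<open>l\<close>. The slope \<open>e / 2\<close> left over by
      the approximation of \<open>\<alpha>\<close> is split between the quadratic term and the defect of the angle.\<close>
    have "?d\<^sup>2 \<le> (r * (k * h))\<^sup>2 + (1 * l)\<^sup>2 - 2 * (k * h) * l * germ_inner (G n) w"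
      using elim k w
      by (intro hinge_comparison_germ_inner[OF surface rT(2) cw]) (auto simp: rT field_simps)
    moreover have "2 * (k * h) * l * (- (e / (4 * k))) \<le> 2 * (k * h) * l * germ_inner (G n) w"
      using n(1) elim k w by (intro mult_left_mono) auto
    moreover have "2 * (k * h) * l * (- (e / (4 * k))) = - (l * e * h / 2)"
      using k by (simp add: field_simps)
    moreover have "2 * l * ((r * k)\<^sup>2 * h / (2 * l) * h) = (r * (k * h))\<^sup>2"
      using w(2) by (simp add: power2_eq_square)
    moreover have "2 * l * (e / 4 * h) = l * e * h / 2" by simp
    ultimately have "?d\<^sup>2 \<le> l\<^sup>2 + 2 * l * ((r * k)\<^sup>2 * h / (2 * l) * h + e / 4 * h)"
      unfolding distrib_left[of "2 * l"] mult_1 by linarith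
    also have "\<dots> \<le> l\<^sup>2 + 2 * l * (e / 4 * h + e / 4 * h)"
      using elim w(2) by (intro add_left_mono mult_left_mono add_right_mono mult_right_mono) auto
    also have "\<dots> \<le> (l + e / 2 * h)\<^sup>2"
      by (simp add: power2_sum)
    finally have "?d \<le> l + e / 2 * h"
      by (rule power2_le_imp_le) (use e elim w in auto)
    then show ?case
      using elim(2) dist_triangle[of "\<alpha> (t + h)" "w l" "G n (k * h)"] by simp
  qed
qed

text \<open>The normalization by \<open>|G|\<^sup>2\<close> is chosen to make \<open>f\<close> grow at unit rate, since
\<open>df(G / |G|\<^sup>2) = \<langle>G, G\<rangle> / |G|\<^sup>2 = 1\<close>.\<close>

lemma normalized_gradient_curve_deriv:
  assumes G: "is_gradient \<Omega> f (\<alpha> t) G" and pos: "0 < tangent_norm G"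
    and tangent: "has_right_tangent \<alpha> t (tangent_scale (1 / (tangent_norm G)\<^sup>2) G)"
    and e: "0 < e"
  shows "\<forall>\<^sub>F h in at_right 0. \<bar>f (\<alpha> (t + h)) - f (\<alpha> t) - h\<bar> \<le> e * h"
proof -
  define k where "k = 1 / (tangent_norm G)\<^sup>2"
  have k: "0 < k" using pos by (simp add: k_def)
  have V: "tangent_vector \<Omega> (\<alpha> t) G" using G by (simp add: is_gradient_def)
  have "differential f G = 1 / k"
    using G tangent_inner_self[OF surface V] by (simp add: is_gradient_def k_def)
  then have "(\<lambda>n. k * germ_deriv f (G n)) \<longlonglongrightarrow> k * (1 / k)"
    using tendsto_mult_left[OF germ_deriv_tendsto_differential[OF V], of k] by metis
  then have "(\<lambda>n. k * germ_deriv f (G n)) \<longlonglongrightarrow> 1" using k by simp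
  then have "\<forall>\<^sub>F n in sequentially. dist (k * germ_deriv f (G n)) 1 < e / 4"
    using e by (intro tendstoD) auto
  moreover have "\<forall>\<^sub>F n in sequentially. \<forall>\<^sub>F h in at_right 0. dist (\<alpha> (t + h)) (G n (k * h)) \<le> e / 2 * h"
    by (rule has_right_tangent_approx) (use tangent e in \<open>auto simp: k_def\<close>)
  ultimately have "\<forall>\<^sub>F n in sequentially. dist (k * germ_deriv f (G n)) 1 < e / 4 \<and>
      (\<forall>\<^sub>F h in at_right 0. dist (\<alpha> (t + h)) (G n (k * h)) \<le> e / 2 * h)"
    by (rule eventually_conj)
  then obtain n where n: "dist (k * germ_deriv f (G n)) 1 < e / 4"
    "\<forall>\<^sub>F h in at_right 0. dist (\<alpha> (t + h)) (G n (k * h)) \<le> e / 2 * h"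
    by (auto simp: eventually_sequentially)
  have "filterlim (\<lambda>h. k * h) (at_right 0) (at_right 0)"
    using k by (intro filterlim_times_pos[of "\<lambda>h. h" 0]) (auto simp: filterlim_ident)
  then have "((\<lambda>h. (f (G n (k * h)) - f (G n 0)) / (k * h)) \<longlongrightarrow> germ_deriv f (G n)) (at_right 0)"
    by (rule filterlim_compose[OF geodesic_germ_slope_tendsto[OF tangent_vector_germ[OF V]]])
  then have "((\<lambda>h. k * ((f (G n (k * h)) - f (G n 0)) / (k * h))) \<longlongrightarrow> k * germ_deriv f (G n)) (at_right 0)"
    by (intro tendsto_intros)
  then have "\<forall>\<^sub>F h in at_right 0. dist (k * ((f (G n (k * h)) - f (G n 0)) / (k * h))) (k * germ_deriv f (G n)) < e / 4"
    using e by (intro tendstoD) auto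
  then show ?thesis
    using n(2) eventually_at_right_less[of "0::real"]
  proof eventually_elim
    case (elim h)
    have start: "G n 0 = \<alpha> t" using tangent_vector_germ[OF V, of n] by (auto elim: geodesic_germE)
    have "\<bar>(f (G n (k * h)) - f (\<alpha> t)) / h - k * germ_deriv f (G n)\<bar> < e / 4"
      using elim(1) k by (simp add: start dist_real_def)
    then have "\<bar>(f (G n (k * h)) - f (\<alpha> t)) / h - 1\<bar> \<le> e / 2"
      using n(1) unfolding dist_real_def by linarith
    then have "\<bar>(f (G n (k * h)) - f (\<alpha> t)) / h - 1\<bar> * h \<le> e / 2 * h"
      using elim by (intro mult_right_mono) auto
    moreover have "\<bar>(f (G n (k * h)) - f (\<alpha> t)) / h - 1\<bar> * h = \<bar>((f (G n (k * h)) - f (\<alpha> t)) / h - 1) * h\<bar>"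
      using elim by (simp add: abs_mult)
    moreover have "((f (G n (k * h)) - f (\<alpha> t)) / h - 1) * h = f (G n (k * h)) - f (\<alpha> t) - h"
      using elim by (simp add: field_simps)
    ultimately have "\<bar>f (G n (k * h)) - f (\<alpha> t) - h\<bar> \<le> e / 2 * h" by simp
    then show ?case
      using elim(2) lipschitz[of "\<alpha> (t + h)" "G n (k * h)"] by linarith
  qed
qed

end

lemma min_geodesic_forward:
  "min_geodesic \<gamma> a b \<Longrightarrow> a \<le> c \<Longrightarrow> 0 \<le> l \<Longrightarrow> c + l \<le> b \<Longrightarrow> min_geodesic (\<lambda>x. \<gamma> (c + x)) 0 l"
  unfolding min_geodesic_def by auto

lemma min_geodesic_backward:
  "min_geodesic \<gamma> a b \<Longrightarrow> c \<le> b \<Longrightarrow> 0 \<le> l \<Longrightarrow> a \<le> c - l \<Longrightarrow> min_geodesic (\<lambda>x. \<gamma> (c - x)) 0 l"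
  unfolding min_geodesic_def by auto

context concave_function_on_convex_set
begin

lemma normalized_gradient_curve_first_variation:
  assumes "normalized_gradient_curve \<Omega> f \<delta> \<alpha>" "0 \<le> t" "t < \<delta>"
    and "min_geodesic w 0 l" "0 < l" "w ` {0..l} \<subseteq> \<Omega>" "w 0 = \<alpha> t" "f (\<alpha> t) \<le> f (w l)" "0 < e"
  shows "\<forall>\<^sub>F h in at_right 0. dist (\<alpha> (t + h)) (w l) \<le> l + e * h"
proof -
  obtain G where "is_gradient \<Omega> f (\<alpha> t) G" "0 < tangent_norm G"
    "has_right_tangent \<alpha> t (tangent_scale (1 / (tangent_norm G)\<^sup>2) G)"
    using assms(1-3) unfolding normalized_gradient_curve_def by (meson atLeastLessThan_iff)
  from first_variation[OF this assms(4-9)] show ?thesis .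
qed

text \<open>Curves starting on the same level therefore stay on a common level at equal times. Without this the
different speeds \<open>1 / |G|\<close> of two curves could drive them apart.\<close>

lemma normalized_gradient_curve_value:
  assumes curve: "normalized_gradient_curve \<Omega> f \<delta> \<alpha>" and t: "0 \<le> t" "t \<le> \<delta>"
  shows "f (\<alpha> t) = f (\<alpha> 0) + t"
proof -
  have "continuous_on UNIV f"
    unfolding continuous_on_iff dist_real_def using lipschitz by (meson le_less_trans)
  moreover have "continuous_on {0..t} \<alpha>"
    using curve t unfolding normalized_gradient_curve_def by (auto intro: continuous_on_subset)
  ultimately have cont: "continuous_on {0..t} (\<lambda>s. f (\<alpha> s))"
    by (rule continuous_on_compose2) auto
  have deriv: "\<forall>\<^sub>F h in at_right 0. \<bar>f (\<alpha> (s + h)) - f (\<alpha> s) - h\<bar> \<le> e * h"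
    if s: "0 \<le> s" "s < t" and e: "0 < e" for s e
  proof -
    obtain G where "is_gradient \<Omega> f (\<alpha> s) G" "0 < tangent_norm G"
      "has_right_tangent \<alpha> s (tangent_scale (1 / (tangent_norm G)\<^sup>2) G)"
      using curve s t unfolding normalized_gradient_curve_def
      by (meson atLeastLessThan_iff order.strict_trans2)
    from normalized_gradient_curve_deriv[OF this e] show ?thesis .
  qed
  have "f (\<alpha> t) - t \<le> f (\<alpha> 0) - 0"
  proof (rule Dini_nonpos_imp_le[where g = "\<lambda>s. f (\<alpha> s) - s"])
    fix s e :: real assume "0 \<le> s" "s < t" "0 < e"
    from deriv[OF this] show "\<forall>\<^sub>F h in at_right 0. f (\<alpha> (s + h)) - (s + h) \<le> f (\<alpha> s) - s + e * h"
      by eventually_elim linarith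
  qed (use t cont in \<open>auto intro!: continuous_intros\<close>)
  moreover have "t - f (\<alpha> t) \<le> 0 - f (\<alpha> 0)"
  proof (rule Dini_nonpos_imp_le[where g = "\<lambda>s. s - f (\<alpha> s)"])
    fix s e :: real assume "0 \<le> s" "s < t" "0 < e"
    from deriv[OF this] show "\<forall>\<^sub>F h in at_right 0. s + h - f (\<alpha> (s + h)) \<le> s - f (\<alpha> s) + e * h"
      by eventually_elim linarith
  qed (use t cont in \<open>auto intro!: continuous_intros\<close>)
  ultimately show ?thesis by simp
qed

text \<open>At each time the two points lie on one level, so by concavity the midpoint of a geodesic joining
them inside \<open>\<Omega>\<close> lies on the same or a higher level. By the first variation neither point moves away
from the midpoint to first order, and the triangle inequality through the fixed midpoint bounds the
growth of the distance between the two moving points.\<close>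

lemma normalized_gradient_curves_contract:
  assumes \<alpha>: "normalized_gradient_curve \<Omega> f \<delta> \<alpha>" and \<beta>: "normalized_gradient_curve \<Omega> f \<delta> \<beta>"
    and level: "f (\<alpha> 0) = f (\<beta> 0)" and t: "0 \<le> t" "t \<le> u" "u \<le> \<delta>"
  shows "dist (\<alpha> u) (\<beta> u) \<le> dist (\<alpha> t) (\<beta> t)"
proof (rule continuous_Dini_nonpos_where_pos_imp_le[where g = "\<lambda>s. dist (\<alpha> s) (\<beta> s)"])
  show "continuous_on {t..u} (\<lambda>s. dist (\<alpha> s) (\<beta> s))"
    using \<alpha> \<beta> t unfolding normalized_gradient_curve_def
    by (auto intro!: continuous_intros elim: continuous_on_subset)
  fix s e :: real
  assume s: "t \<le> s" "s < u" and pos: "0 < dist (\<alpha> s) (\<beta> s)" and e: "0 < e"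
  have s': "0 \<le> s" "s < \<delta>" "s \<le> \<delta>" using s t by auto
  have in\<Omega>: "\<alpha> s \<in> \<Omega>" "\<beta> s \<in> \<Omega>"
    using \<alpha> \<beta> s' unfolding normalized_gradient_curve_def by (auto simp: image_subset_iff)
  obtain \<gamma> l where \<gamma>: "min_geodesic \<gamma> 0 l" "\<gamma> 0 = \<alpha> s" "\<gamma> l = \<beta> s" "\<gamma> ` {0<..<l} \<subseteq> \<Omega>"
    using convex in\<Omega> unfolding geodesically_convex_def by metis
  have "dist (\<gamma> 0) (\<gamma> l) = \<bar>0 - l\<bar>" "0 \<le> l" using \<gamma>(1) unfolding min_geodesic_def by auto
  then have l: "l = dist (\<alpha> s) (\<beta> s)" using \<gamma> by simp
  then have l0: "0 < l" using pos by simp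
  have "\<gamma> x \<in> \<Omega>" if "x \<in> {0..l}" for x
    using that \<gamma> in\<Omega> by (cases "x = 0 \<or> x = l") (auto simp: image_subset_iff)
  then have \<gamma>\<Omega>: "\<gamma> ` {0..l} \<subseteq> \<Omega>" by blast
  have "f (\<alpha> s) = f (\<beta> s)"
    using normalized_gradient_curve_value[OF \<alpha> s'(1,3)] normalized_gradient_curve_value[OF \<beta> s'(1,3)] level by simp
  moreover have "(f (\<gamma> l) - f (\<gamma> 0)) / l \<le> (f (\<gamma> (l/2)) - f (\<gamma> 0)) / (l/2)"
    by (rule concave_on_slope_from_0[where T = l])
       (use concave \<gamma>(1) \<gamma>\<Omega> l0 in \<open>auto simp: geodesically_concave_on_def\<close>)
  ultimately have mid: "f (\<alpha> s) \<le> f (\<gamma> (l/2))" "f (\<beta> s) \<le> f (\<gamma> (l/2))"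
    using l0 \<gamma> by (auto simp: zero_le_divide_iff)
  have "\<forall>\<^sub>F h in at_right 0. dist (\<alpha> (s + h)) ((\<lambda>x. \<gamma> (0 + x)) (l/2)) \<le> l/2 + e/2 * h"
  proof (rule normalized_gradient_curve_first_variation[OF \<alpha> s'(1,2)])
    show "min_geodesic (\<lambda>x. \<gamma> (0 + x)) 0 (l/2)"
      by (rule min_geodesic_forward[OF \<gamma>(1)]) (use l0 in auto)
    show "(\<lambda>x. \<gamma> (0 + x)) ` {0..l/2} \<subseteq> \<Omega>"
      using \<gamma>\<Omega> l0 by (auto simp: image_subset_iff)
  qed (use l0 e \<gamma> mid in auto)
  moreover have "\<forall>\<^sub>F h in at_right 0. dist (\<beta> (s + h)) ((\<lambda>x. \<gamma> (l - x)) (l/2)) \<le> l/2 + e/2 * h"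
  proof (rule normalized_gradient_curve_first_variation[OF \<beta> s'(1,2)])
    show "min_geodesic (\<lambda>x. \<gamma> (l - x)) 0 (l/2)"
      by (rule min_geodesic_backward[OF \<gamma>(1)]) (use l0 in auto)
    show "(\<lambda>x. \<gamma> (l - x)) ` {0..l/2} \<subseteq> \<Omega>"
      using \<gamma>\<Omega> l0 by (auto simp: image_subset_iff)
  qed (use l0 e \<gamma> mid in auto)
  ultimately show "\<forall>\<^sub>F h in at_right 0. dist (\<alpha> (s + h)) (\<beta> (s + h)) \<le> dist (\<alpha> s) (\<beta> s) + e * h"
  proof eventually_elim
    case (elim h)
    moreover have "dist (\<alpha> (s + h)) (\<beta> (s + h)) \<le> dist (\<alpha> (s + h)) (\<gamma> (l/2)) + dist (\<beta> (s + h)) (\<gamma> (l/2))"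
      by (rule dist_triangle2)
    ultimately show ?case unfolding l[symmetric] by simp
  qed
qed (use t in auto)

end

section \<open>Length of curves\<close>

lemma partition_mono:
  fixes u :: "nat \<Rightarrow> real"
  assumes "\<forall>i<n. u i \<le> u (Suc i)" "i \<le> j" "j \<le> n"
  shows "u i \<le> u j"
  using assms(2,3)
proof (induction j rule: dec_induct)
  case (step j)
  then show ?case using assms(1) by (meson Suc_le_lessD less_imp_le order_trans)
qed simp

lemma curve_length_le_iff:
  "curve_length \<gamma> a b \<le> B \<longleftrightarrow>
    (\<forall>n u. u 0 = a \<and> u n = b \<and> (\<forall>i<n. u i \<le> u (Suc i)) \<longrightarrow>
      ereal (\<Sum>i<n. dist (\<gamma> (u i)) (\<gamma> (u (Suc i)))) \<le> B)"
  unfolding curve_length_def SUP_le_iff by auto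

lemma curve_length_mono:
  fixes \<gamma> \<gamma>' :: "real \<Rightarrow> 'a::metric_space"
  assumes "\<And>x y. x \<in> {a..b} \<Longrightarrow> y \<in> {a..b} \<Longrightarrow> dist (\<gamma> x) (\<gamma> y) \<le> dist (\<gamma>' x) (\<gamma>' y)"
  shows "curve_length \<gamma> a b \<le> curve_length \<gamma>' a b"
  unfolding curve_length_le_iff[of \<gamma>]
proof (intro allI impI)
  fix n u assume u: "u 0 = a \<and> u n = b \<and> (\<forall>i<n. u i \<le> u (Suc i))"
  then have "u i \<in> {a..b}" if "i \<le> n" for i
    using partition_mono[of n u 0 i] partition_mono[of n u i n] that by auto
  then have "(\<Sum>i<n. dist (\<gamma> (u i)) (\<gamma> (u (Suc i)))) \<le> (\<Sum>i<n. dist (\<gamma>' (u i)) (\<gamma>' (u (Suc i))))"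
    by (intro sum_mono assms) auto
  moreover have "ereal (\<Sum>i<n. dist (\<gamma>' (u i)) (\<gamma>' (u (Suc i)))) \<le> curve_length \<gamma>' a b"
    using u curve_length_le_iff[of \<gamma>' a b "curve_length \<gamma>' a b"] by blast
  ultimately show "ereal (\<Sum>i<n. dist (\<gamma> (u i)) (\<gamma> (u (Suc i)))) \<le> curve_length \<gamma>' a b"
    by (meson ereal_less_eq(3) order_trans)
qed

lemma dist_le_curve_length:
  assumes "a \<le> b"
  shows "ereal (dist (\<gamma> a) (\<gamma> b)) \<le> curve_length \<gamma> a b"
  unfolding curve_length_def
  by (rule SUP_upper2[where i = "(1, \<lambda>i. if i = 0 then a else b)"]) (use assms in auto)

lemma curve_length_min_geodesic_le:
  assumes "min_geodesic \<gamma> a b"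
  shows "curve_length \<gamma> a b \<le> ereal (b - a)"
  unfolding curve_length_le_iff
proof (intro allI impI)
  fix n u assume u: "u 0 = a \<and> u n = b \<and> (\<forall>i<n. u i \<le> u (Suc i))"
  then have "u i \<in> {a..b}" if "i \<le> n" for i
    using partition_mono[of n u 0 i] partition_mono[of n u i n] that by auto
  then have "(\<Sum>i<n. dist (\<gamma> (u i)) (\<gamma> (u (Suc i)))) = (\<Sum>i<n. u (Suc i) - u i)"
    using assms u unfolding min_geodesic_def by (intro sum.cong) auto
  then show "ereal (\<Sum>i<n. dist (\<gamma> (u i)) (\<gamma> (u (Suc i)))) \<le> ereal (b - a)"
    using u by (simp add: sum_lessThan_telescope)
qed

section \<open>Right derivatives of nonincreasing functions\<close>

lemma upper_right_deriv_nonpos: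
  assumes "u < b" and "\<And>v. u < v \<Longrightarrow> v \<le> b \<Longrightarrow> g v \<le> g u"
  shows "upper_right_deriv g u \<le> 0"
  unfolding upper_right_deriv_def
proof (rule Limsup_bounded)
  show "\<forall>\<^sub>F v in at_right u. ereal ((g v - g u) / (v - u)) \<le> 0"
    unfolding eventually_at_right_field
    using assms by (intro exI[of _ b]) (auto simp: divide_nonpos_pos)
qed

text \<open>The upper right derivative of \<open>g\<close> is nonpositive after \<open>0\<close> because \<open>g\<close> is nonincreasing. A
negative derivative at \<open>0\<close> itself could make its difference quotients positive, which the last
assumption excludes.\<close>

lemma upper_right_deriv2_nonpos:
  assumes "0 < b" and anti: "\<And>u v. 0 \<le> u \<Longrightarrow> u \<le> v \<Longrightarrow> v \<le> b \<Longrightarrow> g v \<le> g u"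
    and deriv: "(g has_real_derivative 0) (at_right 0)"
  shows "upper_right_deriv2 g 0 \<le> 0"
  unfolding upper_right_deriv2_def upper_right_deriv_eq[OF deriv]
proof (rule Limsup_bounded)
  have "upper_right_deriv g u \<le> 0" if "0 < u" "u < b" for u
    by (rule upper_right_deriv_nonpos[OF that(2)]) (use that anti in auto)
  then show "\<forall>\<^sub>F u in at_right 0. (upper_right_deriv g u - ereal 0) / ereal (u - 0) \<le> 0"
    unfolding eventually_at_right_field
    using assms(1) by (intro exI[of _ b]) (auto simp: zero_ereal_def[symmetric] ereal_divide_le_pos)
qed

section \<open>The second derivative of the length\<close>

theorem theorem3p5:
  fixes \<Omega>\<^sub>0 :: "'a::complete_space set"
    and \<sigma> :: "real \<Rightarrow> 'a"
    and f :: "'a \<Rightarrow> real"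
    and \<phi> :: "'a \<Rightarrow> real \<Rightarrow> 'a"
    and L :: "real \<Rightarrow> ereal"
    and \<epsilon> L\<^sub>0 \<delta> :: real
  assumes surface: "nonneg_curved_alexandrov_surface TYPE('a)"
    and domain: "compact \<Omega>\<^sub>0" "geodesically_convex \<Omega>\<^sub>0" "interior \<Omega>\<^sub>0 \<noteq> {}"
    and pos: "0 < \<epsilon>" "0 < L\<^sub>0" "0 < \<delta>"
    and geodesic: "min_geodesic \<sigma> (- \<epsilon>) (L\<^sub>0 + \<epsilon>)"
    and boundary: "\<sigma> ` {- \<epsilon>..L\<^sub>0 + \<epsilon>} \<subseteq> frontier \<Omega>\<^sub>0"
    and f: "\<And>x. f x = infdist x (frontier \<Omega>\<^sub>0)"
    and concave: "geodesically_concave_on \<Omega>\<^sub>0 f"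
    and flow: "\<And>q. q \<in> frontier \<Omega>\<^sub>0 \<Longrightarrow>
                 \<phi> q 0 = q \<and> normalized_gradient_curve \<Omega>\<^sub>0 f \<delta> (\<phi> q)"
    and L: "\<And>t. L t = curve_length (\<lambda>s. \<phi> (\<sigma> s) t) 0 L\<^sub>0"
  shows "(\<forall>t\<in>{0..\<delta>}. L t < \<infinity>) \<and>
         (\<exists>D. ((\<lambda>t. real_of_ereal (L t)) has_real_derivative D) (at_right 0)) \<and>
         upper_right_deriv2 (\<lambda>t. real_of_ereal (L t)) 0 \<le> 0"
proof -
  interpret concave_function_on_convex_set \<Omega>\<^sub>0 f
    by unfold_locales (use surface concave domain(2) in \<open>auto simp: f infdist_triangle_abs\<close>)
  have start: "\<phi> (\<sigma> s) 0 = \<sigma> s" and curve: "normalized_gradient_curve \<Omega>\<^sub>0 f \<delta> (\<phi> (\<sigma> s))"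
    and zero: "f (\<sigma> s) = 0" and in\<Omega>: "\<sigma> s \<in> \<Omega>\<^sub>0"
    if "s \<in> {- \<epsilon>..L\<^sub>0 + \<epsilon>}" for s
  proof -
    have *: "\<sigma> s \<in> frontier \<Omega>\<^sub>0" using boundary that by blast
    then show "\<phi> (\<sigma> s) 0 = \<sigma> s" "normalized_gradient_curve \<Omega>\<^sub>0 f \<delta> (\<phi> (\<sigma> s))" "f (\<sigma> s) = 0"
      using flow by (auto simp: f)
    show "\<sigma> s \<in> \<Omega>\<^sub>0"
      using * frontier_subset_closed[OF compact_imp_closed[OF domain(1)]] by blast
  qed
  define \<alpha> where "\<alpha> = \<phi> (\<sigma> 0)"
  define \<beta> where "\<beta> = \<phi> (\<sigma> L\<^sub>0)"
  have anti: "L u \<le> L t" if "0 \<le> t" "t \<le> u" "u \<le> \<delta>" for t u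
    unfolding L
  proof (rule curve_length_mono)
    fix x y assume "x \<in> {0..L\<^sub>0}" "y \<in> {0..L\<^sub>0}"
    then have "x \<in> {- \<epsilon>..L\<^sub>0 + \<epsilon>}" "y \<in> {- \<epsilon>..L\<^sub>0 + \<epsilon>}" using pos by auto
    then show "dist (\<phi> (\<sigma> x) u) (\<phi> (\<sigma> y) u) \<le> dist (\<phi> (\<sigma> x) t) (\<phi> (\<sigma> y) t)"
      using that curve start zero by (intro normalized_gradient_curves_contract[of \<delta>]) auto
  qed
  have lower: "ereal (dist (\<alpha> t) (\<beta> t)) \<le> L t" for t
    unfolding L \<alpha>_def \<beta>_def using dist_le_curve_length[of 0 L\<^sub>0 "\<lambda>s. \<phi> (\<sigma> s) t"] pos by simp
  have "L 0 \<le> curve_length \<sigma> 0 L\<^sub>0"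
    unfolding L by (rule curve_length_mono) (use start pos in auto)
  also have "\<dots> \<le> ereal (L\<^sub>0 - 0)"
    by (rule curve_length_min_geodesic_le) (use geodesic pos in \<open>auto simp: min_geodesic_def\<close>)
  finally have L0_le: "L 0 \<le> ereal L\<^sub>0" by simp
  have L0_ge: "ereal L\<^sub>0 \<le> L 0"
    using lower[of 0] start[of 0] start[of L\<^sub>0] pos geodesic
    by (simp add: \<alpha>_def \<beta>_def min_geodesic_def)
  define g where "g t = real_of_ereal (L t)" for t
  have Lg: "L t = ereal (g t)" if "0 \<le> t" "t \<le> \<delta>" for t
  proof -
    have "L t \<le> ereal L\<^sub>0" using anti[of 0 t] that L0_le by simp
    then have "L t \<noteq> \<infinity>" by auto
    moreover have "L t \<noteq> -\<infinity>" using lower[of t] by auto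
    ultimately show ?thesis by (cases "L t") (auto simp: g_def)
  qed
  have g_anti: "g u \<le> g t" if "0 \<le> t" "t \<le> u" "u \<le> \<delta>" for t u
    using anti[OF that] Lg[of t] Lg[of u] that by simp
  have g0: "g 0 = L\<^sub>0" using L0_le L0_ge Lg[of 0] pos by simp
  have g_lower: "dist (\<alpha> t) (\<beta> t) \<le> g t" if "0 \<le> t" "t \<le> \<delta>" for t
    using lower[of t] Lg[OF that] by simp
  \<comment> \<open>Since \<open>f\<close> vanishes on \<open>\<sigma>\<close>, the curves \<open>\<alpha>\<close> and \<open>\<beta>\<close> do not move away, to first order, from the
    outer points \<open>\<sigma> (- \<epsilon>)\<close> and \<open>\<sigma> (L\<^sub>0 + \<epsilon>)\<close>. These stay at distance \<open>L\<^sub>0 + 2 \<epsilon>\<close>, so \<open>\<alpha> h\<close> and \<open>\<beta> h\<close>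
    have distance at least \<open>L\<^sub>0 - o(h)\<close>.\<close>
  have deriv: "(g has_real_derivative 0) (at_right 0)"
    unfolding has_field_derivative_iff tendsto_iff
  proof (intro allI impI)
    fix e :: real assume e: "0 < e"
    have "\<forall>\<^sub>F h in at_right 0. dist (\<alpha> (0 + h)) ((\<lambda>x. \<sigma> (0 - x)) \<epsilon>) \<le> \<epsilon> + e / 3 * h"
    proof (rule normalized_gradient_curve_first_variation[of \<delta>])
      show "min_geodesic (\<lambda>x. \<sigma> (0 - x)) 0 \<epsilon>"
        by (rule min_geodesic_backward[OF geodesic]) (use pos in auto)
      show "(\<lambda>x. \<sigma> (0 - x)) ` {0..\<epsilon>} \<subseteq> \<Omega>\<^sub>0"
        using in\<Omega> pos by auto
    qed (use pos e curve[of 0] start[of 0] zero[of 0] zero[of "-\<epsilon>"] in \<open>auto simp: \<alpha>_def\<close>)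
    moreover have "\<forall>\<^sub>F h in at_right 0. dist (\<beta> (0 + h)) ((\<lambda>x. \<sigma> (L\<^sub>0 + x)) \<epsilon>) \<le> \<epsilon> + e / 3 * h"
    proof (rule normalized_gradient_curve_first_variation[of \<delta>])
      show "min_geodesic (\<lambda>x. \<sigma> (L\<^sub>0 + x)) 0 \<epsilon>"
        by (rule min_geodesic_forward[OF geodesic]) (use pos in auto)
      show "(\<lambda>x. \<sigma> (L\<^sub>0 + x)) ` {0..\<epsilon>} \<subseteq> \<Omega>\<^sub>0"
        using in\<Omega> pos by auto
    qed (use pos e curve[of L\<^sub>0] start[of L\<^sub>0] zero[of L\<^sub>0] zero[of "L\<^sub>0 + \<epsilon>"] in \<open>auto simp: \<beta>_def\<close>)
    moreover have "\<forall>\<^sub>F h in at_right 0. h < \<delta>"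
      using pos by (intro order_tendstoD(2)[OF tendsto_ident_at]) auto
    ultimately show "\<forall>\<^sub>F h in at_right 0. dist ((g h - g 0) / (h - 0)) 0 < e"
      using eventually_at_right_less[of "0::real"]
    proof eventually_elim
      case (elim h)
      have "dist (\<sigma> (- \<epsilon>)) (\<sigma> (L\<^sub>0 + \<epsilon>)) = L\<^sub>0 + 2 * \<epsilon>"
        using geodesic pos by (simp add: min_geodesic_def)
      moreover have "dist (\<sigma> (- \<epsilon>)) (\<sigma> (L\<^sub>0 + \<epsilon>))
          \<le> dist (\<alpha> h) (\<sigma> (- \<epsilon>)) + dist (\<alpha> h) (\<beta> h) + dist (\<beta> h) (\<sigma> (L\<^sub>0 + \<epsilon>))"
        using dist_triangle3[of "\<sigma> (- \<epsilon>)" "\<sigma> (L\<^sub>0 + \<epsilon>)" "\<alpha> h"]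
          dist_triangle[of "\<alpha> h" "\<sigma> (L\<^sub>0 + \<epsilon>)" "\<beta> h"] by linarith
      moreover have "dist (\<alpha> h) (\<beta> h) \<le> g h" using g_lower[of h] elim by simp
      ultimately have "g 0 - g h \<le> 2 / 3 * e * h"
        using elim by (simp add: g0)
      also have "\<dots> < e * h" using elim e by simp
      finally have "g 0 - g h < e * h" .
      moreover have "g h \<le> g 0" using g_anti[of 0 h] elim by simp
      ultimately show ?case
        using elim by (simp add: dist_real_def abs_of_nonpos divide_nonpos_pos) (simp add: field_simps)
    qed
  qed
  have "upper_right_deriv2 g 0 \<le> 0"
    by (rule upper_right_deriv2_nonpos[OF pos(3) g_anti deriv])
  moreover have "g = (\<lambda>t. real_of_ereal (L t))" by (simp add: g_def fun_eq_iff)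
  moreover have "\<forall>t\<in>{0..\<delta>}. L t < \<infinity>" using Lg by simp
  ultimately show ?thesis using deriv by auto
qed

end
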